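(* Let $\delta_c\in(0,1)$ and let $M_c\in\mathbb{R}^{n\times\rho_c}$ be a column subsampling matrix such that $$(1-\delta_c)\,\|w\|_2^2\le\frac{n}{\rho_c}\,\|w^\top M_c\|_2^2\le(1+\delta_c)\,\|w\|_2^2\quad\text{for all }w\in\mathrm{span}(Q_{k_c}).$$ Assume $\lambda_{k_c+1}>0$. For $i=1,\dots,k$, let $\bar c_i\in\mathrm{span}(Q_{k_c})$, let $\tilde c_i=M_c^\top\bar c_i$, let $c_i$ be a solution of $$\min_{c\in\mathbb{R}^n}\ c^\top\mathcal{L}_cc\quad\text{s.t. }M_c^\top c=\tilde c_i,$$ and let $c_i^*=Q_{k_c}Q_{k_c}^\top c_i$. Then, for every $i$, $$\|c_i^*-\bar c_i\|_2\le\sqrt{\frac{n}{\rho_c(1-\delta_c)}}\,\sqrt{\frac{\lambda_{k_c}}{\lambda_{k_c+1}}}\ \|\bar c_i\|_2.$$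
   Context: $\mathcal{L}_c\in\mathbb{R}^{n\times n}$ is the Laplacian of an undirected graph on $n$ vertices with nonnegative weights. Write $\mathcal{L}_c=Q\Lambda_cQ^\top$ with $Q$ orthogonal and eigenvalues sorted in increasing order; $Q_{k_c}\in\mathbb{R}^{n\times k_c}$ consists of the first $k_c$ columns of $Q$ ($k_c<n$), $\mathrm{span}(Q_{k_c})$ is the span of its columns, and $\lambda_{k_c},\lambda_{k_c+1}$ are the $k_c$-th and $(k_c+1)$-th smallest eigenvalues of $\mathcal{L}_c$. Subsampling matrix: for distinct indices $\omega_1,\dots,\omega_{\rho_c}\in\{1,\dots,n\}$, $(M_c)_{ij}=1$ if $i=\omega_j$ and $0$ otherwise. The vectors $c_i$, $i=1,\dots,k$, play the role of (relaxed) cluster indicator vectors for $k$ clusters. *)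

theory Defs
  imports Complex_Main "Jordan_Normal_Form.VS_Connect"
begin

definition l2_norm :: "real vec \<Rightarrow> real" where
  "l2_norm v = sqrt (v \<bullet> v)"

text \<open>Undirected weighted graphs on the vertices \<open>0, \<dots>, n - 1\<close> are given by their weight matrix,
  with weight \<open>0\<close> for non-edges.  Diagonal entries (loops) are not excluded: they cancel in the
  Laplacian.\<close>

definition weighted_graph :: "nat \<Rightarrow> real mat \<Rightarrow> bool" where
  "weighted_graph n W \<longleftrightarrow> W \<in> carrier_mat n n \<and>
     (\<forall>i<n. \<forall>j<n. W $$ (i, j) = W $$ (j, i)) \<and> (\<forall>i<n. \<forall>j<n. 0 \<le> W $$ (i, j))"

definition laplacian :: "real mat \<Rightarrow> real mat" where
  "laplacian W = mat_diag (dim_row W) (\<lambda>i. \<Sum>j<dim_col W. W $$ (i, j)) - W"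

text \<open>The library's \<open>orthogonal_mat\<close> asks only for pairwise orthogonal nonzero columns,
  not for unit columns, hence a separate notion.\<close>

definition real_orthogonal_mat :: "nat \<Rightarrow> real mat \<Rightarrow> bool" where
  "real_orthogonal_mat n Q \<longleftrightarrow> Q \<in> carrier_mat n n \<and> Q\<^sup>T * Q = 1\<^sub>m n \<and> Q * Q\<^sup>T = 1\<^sub>m n"

text \<open>\<open>L = Q \<Lambda> Q\<^sup>T\<close> with the eigenvalues in increasing order along the diagonal of \<open>\<Lambda>\<close>.\<close>

definition sorted_eigendecomposition :: "nat \<Rightarrow> real mat \<Rightarrow> real mat \<Rightarrow> real mat \<Rightarrow> bool" where
  "sorted_eigendecomposition n L Q \<Lambda> \<longleftrightarrow> real_orthogonal_mat n Q \<and>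
     \<Lambda> \<in> carrier_mat n n \<and> diagonal_mat \<Lambda> \<and> sorted (diag_mat \<Lambda>) \<and> L = Q * \<Lambda> * Q\<^sup>T"

text \<open>The argument \<open>j\<close> is 1-based: \<open>sorted_eigenvalue \<Lambda> j\<close> is the \<open>j\<close>-th smallest eigenvalue
  (with multiplicity).\<close>

definition sorted_eigenvalue :: "real mat \<Rightarrow> nat \<Rightarrow> real" where
  "sorted_eigenvalue \<Lambda> j = diag_mat \<Lambda> ! (j - 1)"

definition first_cols :: "nat \<Rightarrow> real mat \<Rightarrow> real mat" where
  "first_cols k Q = mat (dim_row Q) k (\<lambda>(i, j). Q $$ (i, j))"

definition col_subsampling_mat :: "nat \<Rightarrow> nat \<Rightarrow> real mat \<Rightarrow> bool" where
  "col_subsampling_mat n \<rho> M \<longleftrightarrow>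
     (\<exists>\<omega> :: nat \<Rightarrow> nat. inj_on \<omega> {..<\<rho>} \<and> \<omega> ` {..<\<rho>} \<subseteq> {..<n} \<and>
        M = mat n \<rho> (\<lambda>(i, j). if i = \<omega> j then 1 else 0))"

end

theory Submission
  imports Defs
begin

text \<open>
  Put \<open>e = c - c\<^sup>*\<close>, which is orthogonal to the span of the first \<open>k\<close> eigenvectors, and
  \<open>d = c\<^sup>* - c_bar\<close>, which lies in that span.  In eigenvector coordinates, and because the Laplacian
  is positive semidefinite,
  \<open>\<lambda>\<^bsub>k+1\<^esub> \<parallel>e\<parallel>\<^sup>2 \<le> c \<bullet> L c \<le> c_bar \<bullet> L c_bar \<le> \<lambda>\<^sub>k \<parallel>c_bar\<parallel>\<^sup>2\<close>,
  where the middle step is minimality of \<open>c\<close> against the feasible point \<open>c_bar\<close>.  Since \<open>c\<close> and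
  \<open>c_bar\<close> have the same samples, \<open>M\<^sup>T d = - M\<^sup>T e\<close>; the restricted isometry bound on \<open>d\<close> and the fact
  that sampling does not increase norms give \<open>(1 - \<delta>) \<parallel>d\<parallel>\<^sup>2 \<le> (n / \<rho>) \<parallel>e\<parallel>\<^sup>2\<close>.
\<close>

section \<open>Norms, the Laplacian form, and sampling\<close>

lemma l2_norm_nonneg: "0 \<le> l2_norm v"
  by (auto simp: l2_norm_def scalar_prod_def intro!: sum_nonneg)

lemma l2_norm_square: "(l2_norm v)\<^sup>2 = (\<Sum>i<dim_vec v. (v $ i)\<^sup>2)"
proof -
  have "v \<bullet> v = (\<Sum>i<dim_vec v. (v $ i)\<^sup>2)"
    by (simp add: scalar_prod_def power2_eq_square atLeast0LessThan)
  then show ?thesis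
    by (simp add: l2_norm_def sum_nonneg)
qed

lemma l2_norm_uminus: "l2_norm (- v) = l2_norm v"
  by (rule power2_eq_imp_eq) (auto simp: l2_norm_square l2_norm_nonneg)

text \<open>Row i of the Laplacian applied to \<open>x\<close> collects the weighted differences
  \<open>x $ i - x $ j\<close>, so loops drop out. The sum is left unsymmetrised here;
  \<open>laplacian_psd\<close> symmetrises it.\<close>

lemma laplacian_quadratic_form:
  assumes "W \<in> carrier_mat n n" "x \<in> carrier_vec n"
  shows "x \<bullet> (laplacian W *\<^sub>v x) = (\<Sum>i<n. \<Sum>j<n. W $$ (i, j) * (x $ i * (x $ i - x $ j)))"
proof -
  have "(laplacian W *\<^sub>v x) $ i = (\<Sum>j<n. W $$ (i, j) * (x $ i - x $ j))" if "i < n" for i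
  proof -
    have "(laplacian W *\<^sub>v x) $ i =
        (\<Sum>j<n. (if i = j then (\<Sum>j<n. W $$ (i, j)) else 0) * x $ j - W $$ (i, j) * x $ j)"
      using assms that
      by (auto simp: laplacian_def mat_diag_def scalar_prod_def atLeast0LessThan algebra_simps
          intro!: sum.cong)
    also have "\<dots> = (\<Sum>j<n. if i = j then (\<Sum>j<n. W $$ (i, j)) * x $ j else 0)
        - (\<Sum>j<n. W $$ (i, j) * x $ j)"
      unfolding sum_subtractf by (intro arg_cong2[where f = "(-)"] sum.cong) auto
    also have "\<dots> = (\<Sum>j<n. W $$ (i, j) * (x $ i - x $ j))"
      using that by (simp add: sum_subtractf sum_distrib_right right_diff_distrib)
    finally show ?thesis .
  qed
  then have "x \<bullet> (laplacian W *\<^sub>v x) = (\<Sum>i<n. x $ i * (\<Sum>j<n. W $$ (i, j) * (x $ i - x $ j)))"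
    using assms by (auto simp: scalar_prod_def atLeast0LessThan laplacian_def)
  then show ?thesis
    by (simp add: sum_distrib_left mult.left_commute)
qed

text \<open>Exchanging the two summation indices and using symmetry of \<open>W\<close> gives a
  second expression for the form. Its sum with the first is a sum of weighted squares of
  differences, so twice the form is nonnegative.\<close>

lemma laplacian_psd:
  assumes "weighted_graph n W" "x \<in> carrier_vec n"
  shows "0 \<le> x \<bullet> (laplacian W *\<^sub>v x)"
proof -
  let ?q = "x \<bullet> (laplacian W *\<^sub>v x)"
  have W: "W \<in> carrier_mat n n" and sym: "\<And>i j. i < n \<Longrightarrow> j < n \<Longrightarrow> W $$ (i, j) = W $$ (j, i)"
    and nonneg: "\<And>i j. i < n \<Longrightarrow> j < n \<Longrightarrow> 0 \<le> W $$ (i, j)"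
    using assms unfolding weighted_graph_def by auto
  note q = laplacian_quadratic_form[OF W assms(2)]
  have "?q = (\<Sum>i<n. \<Sum>j<n. W $$ (j, i) * (x $ j * (x $ j - x $ i)))"
    unfolding q by (rule sum.swap)
  also have "\<dots> = (\<Sum>i<n. \<Sum>j<n. W $$ (i, j) * (x $ j * (x $ j - x $ i)))"
    by (intro sum.cong refl) (simp add: sym)
  finally have "?q + ?q = (\<Sum>i<n. \<Sum>j<n. W $$ (i, j) * (x $ i * (x $ i - x $ j)))
      + (\<Sum>i<n. \<Sum>j<n. W $$ (i, j) * (x $ j * (x $ j - x $ i)))"
    by (rule arg_cong2[where f = "(+)", OF q])
  also have "\<dots> = (\<Sum>i<n. \<Sum>j<n. W $$ (i, j) * (x $ i - x $ j)\<^sup>2)"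
    unfolding sum.distrib[symmetric]
    by (intro sum.cong refl) (simp add: power2_eq_square algebra_simps)
  also have "\<dots> \<ge> 0"
    by (intro sum_nonneg) (auto intro!: mult_nonneg_nonneg nonneg)
  finally show ?thesis by simp
qed

text \<open>The sampled indices are distinct, so each squared entry of \<open>x\<close> is counted
  at most once in the norm of the samples.\<close>

lemma subsampling_norm_le:
  assumes "col_subsampling_mat n \<rho> M" "x \<in> carrier_vec n"
  shows "l2_norm (M\<^sup>T *\<^sub>v x) \<le> l2_norm x"
proof (rule power2_le_imp_le[OF _ l2_norm_nonneg])
  obtain \<omega> where inj: "inj_on \<omega> {..<\<rho>}" and \<omega>: "\<omega> ` {..<\<rho>} \<subseteq> {..<n}"
    and M: "M = mat n \<rho> (\<lambda>(i, j). if i = \<omega> j then 1 else 0)"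
    using assms unfolding col_subsampling_mat_def by auto
  have "(M\<^sup>T *\<^sub>v x) $ j = x $ \<omega> j" if "j < \<rho>" for j
  proof -
    have "(M\<^sup>T *\<^sub>v x) $ j = (\<Sum>i<n. (if i = \<omega> j then 1 else 0) * x $ i)"
      using assms(2) that by (simp add: M scalar_prod_def atLeast0LessThan)
    also have "\<dots> = x $ \<omega> j"
      using \<omega> that by (auto simp: if_distrib[of "\<lambda>c. c * _"] cong: if_cong)
    finally show ?thesis .
  qed
  then have "(l2_norm (M\<^sup>T *\<^sub>v x))\<^sup>2 = (\<Sum>j<\<rho>. (x $ \<omega> j)\<^sup>2)"
    by (simp add: l2_norm_square M)
  also have "\<dots> = (\<Sum>i\<in>\<omega> ` {..<\<rho>}. (x $ i)\<^sup>2)"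
    by (simp add: sum.reindex[OF inj])
  also have "\<dots> \<le> (\<Sum>i<n. (x $ i)\<^sup>2)"
    using \<omega> by (intro sum_mono2) auto
  finally show "(l2_norm (M\<^sup>T *\<^sub>v x))\<^sup>2 \<le> (l2_norm x)\<^sup>2"
    using assms(2) by (simp add: l2_norm_square)
qed

section \<open>Eigenvector coordinates\<close>

lemma real_orthogonal_mat_transpose_isometry:
  assumes "real_orthogonal_mat n Q" "x \<in> carrier_vec n"
  shows "l2_norm (Q\<^sup>T *\<^sub>v x) = l2_norm x"
proof -
  have Q: "Q \<in> carrier_mat n n" "Q * Q\<^sup>T = 1\<^sub>m n"
    using assms unfolding real_orthogonal_mat_def by auto
  have "(Q\<^sup>T *\<^sub>v x) \<bullet> (Q\<^sup>T *\<^sub>v x) = x \<bullet> (Q *\<^sub>v (Q\<^sup>T *\<^sub>v x))"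
    using transpose_vec_mult_scalar[of Q n n "Q\<^sup>T *\<^sub>v x" x] Q assms(2)
    by (simp add: comm_scalar_prod[of _ n])
  also have "Q *\<^sub>v (Q\<^sup>T *\<^sub>v x) = x"
    using Q assms(2) by (simp flip: assoc_mult_mat_vec[of Q n n "Q\<^sup>T" n])
  finally show ?thesis by (simp add: l2_norm_def)
qed

lemma eigendecomposition_quadratic_form:
  assumes "sorted_eigendecomposition n L Q \<Lambda>" "x \<in> carrier_vec n"
  shows "x \<bullet> (L *\<^sub>v x) = (\<Sum>j<n. \<Lambda> $$ (j, j) * ((Q\<^sup>T *\<^sub>v x) $ j)\<^sup>2)"
proof -
  have Q: "Q \<in> carrier_mat n n" and \<Lambda>: "\<Lambda> \<in> carrier_mat n n" "diagonal_mat \<Lambda>"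
    and L: "L = Q * \<Lambda> * Q\<^sup>T"
    using assms unfolding sorted_eigendecomposition_def real_orthogonal_mat_def by auto
  define y where "y = Q\<^sup>T *\<^sub>v x"
  have y: "y \<in> carrier_vec n" using Q assms(2) by (simp add: y_def)
  have "L *\<^sub>v x = Q *\<^sub>v (\<Lambda> *\<^sub>v y)"
    using Q \<Lambda> assms(2) unfolding L y_def
    by (simp add: assoc_mult_mat_vec[of Q n n "\<Lambda> * Q\<^sup>T" n]
        assoc_mult_mat_vec[of \<Lambda> n n "Q\<^sup>T" n])
  then have "x \<bullet> (L *\<^sub>v x) = y \<bullet> (\<Lambda> *\<^sub>v y)"
    using transpose_vec_mult_scalar[of Q n n "\<Lambda> *\<^sub>v y" x] Q \<Lambda> y assms(2)
    by (simp add: y_def)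
  also have "\<dots> = (\<Sum>j<n. y $ j * (\<Lambda> *\<^sub>v y) $ j)"
    using \<Lambda> by (simp add: scalar_prod_def atLeast0LessThan)
  also have "\<dots> = (\<Sum>j<n. \<Lambda> $$ (j, j) * (y $ j)\<^sup>2)"
  proof (intro sum.cong refl)
    fix j assume "j \<in> {..<n}"
    then have j: "j < n" by simp
    have "(\<Lambda> *\<^sub>v y) $ j = (\<Sum>i<n. \<Lambda> $$ (j, i) * y $ i)"
      using \<Lambda> y j by (simp add: scalar_prod_def atLeast0LessThan)
    also have "\<dots> = (\<Sum>i<n. if i = j then \<Lambda> $$ (j, j) * y $ j else 0)"
      using \<Lambda> j by (intro sum.cong refl) (auto simp: diagonal_mat_def)
    also have "\<dots> = \<Lambda> $$ (j, j) * y $ j" using j by simp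
    finally show "y $ j * (\<Lambda> *\<^sub>v y) $ j = \<Lambda> $$ (j, j) * (y $ j)\<^sup>2"
      by (simp add: power2_eq_square)
  qed
  finally show ?thesis by (simp add: y_def)
qed

text \<open>Testing the form on the eigenvector \<open>Q *\<^sub>v unit_vec n j\<close>, whose
  coordinate vector is \<open>unit_vec n j\<close>, returns exactly the diagonal entry.\<close>

lemma eigendecomposition_diag_nonneg:
  assumes "sorted_eigendecomposition n L Q \<Lambda>" "\<And>x. x \<in> carrier_vec n \<Longrightarrow> 0 \<le> x \<bullet> (L *\<^sub>v x)"
    and "j < n"
  shows "0 \<le> \<Lambda> $$ (j, j)"
proof -
  have Q: "Q \<in> carrier_mat n n" "Q\<^sup>T * Q = 1\<^sub>m n"
    using assms unfolding sorted_eigendecomposition_def real_orthogonal_mat_def by auto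
  have x: "Q *\<^sub>v unit_vec n j \<in> carrier_vec n" using Q by simp
  have "Q\<^sup>T *\<^sub>v (Q *\<^sub>v unit_vec n j) = unit_vec n j"
    using Q by (simp flip: assoc_mult_mat_vec[of "Q\<^sup>T" n n Q n])
  with eigendecomposition_quadratic_form[OF assms(1) x]
  have "(Q *\<^sub>v unit_vec n j) \<bullet> (L *\<^sub>v (Q *\<^sub>v unit_vec n j))
      = (\<Sum>i<n. \<Lambda> $$ (i, i) * (unit_vec n j $ i)\<^sup>2)"
    by simp
  also have "\<dots> = (\<Sum>i<n. \<Lambda> $$ (i, i) * (if i = j then 1 else 0)\<^sup>2)"
    by (intro sum.cong refl) (simp add: \<open>j < n\<close>)
  also have "\<dots> = \<Lambda> $$ (j, j)"
    using \<open>j < n\<close> by (simp add: if_distrib[of "\<lambda>c. _ * c\<^sup>2"] cong: if_cong)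
  finally show ?thesis
    using assms(2)[OF x] by simp
qed

lemma sorted_eigenvalue_mono:
  assumes "sorted_eigendecomposition n L Q \<Lambda>" "1 \<le> i" "i \<le> j" "j \<le> n"
  shows "sorted_eigenvalue \<Lambda> i \<le> sorted_eigenvalue \<Lambda> j"
  using assms unfolding sorted_eigendecomposition_def sorted_eigenvalue_def
  by (intro sorted_nth_mono) (auto simp: diag_mat_def)

text \<open>Passes from the 0-based diagonal of \<open>\<Lambda>\<close> to the 1-based numbering of
  eigenvalues; the shifts \<open>j + 1\<close> below come from here.\<close>

lemma eigendecomposition_diag_entry:
  assumes "sorted_eigendecomposition n L Q \<Lambda>" "j < n"
  shows "\<Lambda> $$ (j, j) = sorted_eigenvalue \<Lambda> (j + 1)"
  using assms by (auto simp: sorted_eigendecomposition_def sorted_eigenvalue_def diag_mat_def)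

section \<open>The low eigenspace and the two spectral bounds\<close>

lemma transpose_mult_first_cols_vec:
  assumes "real_orthogonal_mat n Q" "k \<le> n" "z \<in> carrier_vec k"
  shows "Q\<^sup>T *\<^sub>v (first_cols k Q *\<^sub>v z) = vec n (\<lambda>j. if j < k then z $ j else 0)"
proof -
  let ?z = "vec n (\<lambda>j. if j < k then z $ j else 0)"
  have Q: "Q \<in> carrier_mat n n" "Q\<^sup>T * Q = 1\<^sub>m n"
    using assms unfolding real_orthogonal_mat_def by auto
  \<comment> \<open>Padding \<open>z\<close> with zeros replaces the truncated matrix by the full
    \<open>Q\<close>, which multiplication by the transpose then cancels.\<close>
  have "first_cols k Q *\<^sub>v z = Q *\<^sub>v ?z"
  proof (rule eq_vecI)
    fix i assume "i < dim_vec (Q *\<^sub>v ?z)"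
    then have i: "i < n" using Q by simp
    have "(first_cols k Q *\<^sub>v z) $ i = (\<Sum>j<k. Q $$ (i, j) * z $ j)"
      using Q i assms(3) by (auto simp: first_cols_def scalar_prod_def atLeast0LessThan)
    also have "\<dots> = (\<Sum>j<n. Q $$ (i, j) * (if j < k then z $ j else 0))"
      using assms(2) by (intro sum.mono_neutral_cong_left) auto
    also have "\<dots> = (Q *\<^sub>v ?z) $ i"
      using Q i by (auto simp: scalar_prod_def atLeast0LessThan)
    finally show "(first_cols k Q *\<^sub>v z) $ i = (Q *\<^sub>v ?z) $ i" .
  qed (use Q in \<open>simp add: first_cols_def\<close>)
  then show ?thesis
    using Q by (simp flip: assoc_mult_mat_vec[of "Q\<^sup>T" n n Q n])
qed

lemma col_space_first_cols:
  assumes "Q \<in> carrier_mat n n"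
  shows "vec_space.col_space n (first_cols k Q) =
    {first_cols k Q *\<^sub>v z | z :: real vec. z \<in> carrier_vec k}"
proof -
  interpret vec_space "TYPE(real)" n .
  have F: "first_cols k Q \<in> carrier_mat n k" using assms by (simp add: first_cols_def)
  show ?thesis using F unfolding col_space_eq[OF F] by auto
qed

text \<open>Vectors in this span have zero coordinates from index \<open>k\<close> on, so only the
  \<open>k\<close> smallest eigenvalues enter the form, each bounded by the largest among
  them.\<close>

lemma quadratic_form_le_on_low_eigenspace:
  assumes "sorted_eigendecomposition n L Q \<Lambda>" "1 \<le> k" "k \<le> n"
    and "x \<in> vec_space.col_space n (first_cols k Q)"
  shows "x \<bullet> (L *\<^sub>v x) \<le> sorted_eigenvalue \<Lambda> k * (l2_norm x)\<^sup>2"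
proof -
  have orth: "real_orthogonal_mat n Q" and Q: "Q \<in> carrier_mat n n"
    using assms(1) unfolding sorted_eigendecomposition_def real_orthogonal_mat_def by auto
  obtain z where z: "z \<in> carrier_vec k" "x = first_cols k Q *\<^sub>v z"
    using assms(4) unfolding col_space_first_cols[OF Q] by auto
  have "first_cols k Q \<in> carrier_mat n k" using Q by (simp add: first_cols_def)
  then have x: "x \<in> carrier_vec n" using z by simp
  define y where "y = Q\<^sup>T *\<^sub>v x"
  have y: "y = vec n (\<lambda>j. if j < k then z $ j else 0)"
    unfolding y_def z(2) using orth assms(3) z(1) by (rule transpose_mult_first_cols_vec)
  have "x \<bullet> (L *\<^sub>v x) = (\<Sum>j<n. sorted_eigenvalue \<Lambda> (j + 1) * (y $ j)\<^sup>2)"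
    unfolding eigendecomposition_quadratic_form[OF assms(1) x] y_def[symmetric]
    by (intro sum.cong refl) (simp add: eigendecomposition_diag_entry[OF assms(1)])
  also have "\<dots> \<le> (\<Sum>j<n. sorted_eigenvalue \<Lambda> k * (y $ j)\<^sup>2)"
    using assms(3)
    by (intro sum_mono) (auto simp: y intro!: mult_right_mono sorted_eigenvalue_mono[OF assms(1)])
  also have "\<dots> = sorted_eigenvalue \<Lambda> k * (l2_norm y)\<^sup>2"
    by (simp add: l2_norm_square sum_distrib_left y)
  also have "l2_norm y = l2_norm x"
    unfolding y_def by (rule real_orthogonal_mat_transpose_isometry[OF orth x])
  finally show ?thesis .
qed

text \<open>Subtracting the projection erases the first \<open>k\<close> coordinates of
  \<open>x\<close> and keeps the others, which carry eigenvalues from number \<open>k + 1\<close>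
  on. Positive semidefiniteness makes the erased terms of the form nonnegative, so they can be
  discarded.\<close>

lemma projection_residual_le_quadratic_form:
  assumes "sorted_eigendecomposition n L Q \<Lambda>" "k < n" "x \<in> carrier_vec n"
    and psd: "\<And>x. x \<in> carrier_vec n \<Longrightarrow> 0 \<le> x \<bullet> (L *\<^sub>v x)"
  shows "sorted_eigenvalue \<Lambda> (k + 1) *
      (l2_norm (x - (first_cols k Q * (first_cols k Q)\<^sup>T) *\<^sub>v x))\<^sup>2 \<le> x \<bullet> (L *\<^sub>v x)"
proof -
  let ?F = "first_cols k Q"
  have orth: "real_orthogonal_mat n Q" and Q: "Q \<in> carrier_mat n n"
    using assms(1) unfolding sorted_eigendecomposition_def real_orthogonal_mat_def by auto
  have F: "?F \<in> carrier_mat n k" using Q by (simp add: first_cols_def)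
  define y where "y = Q\<^sup>T *\<^sub>v x"
  define e where "e = x - (?F * ?F\<^sup>T) *\<^sub>v x"
  have e: "e \<in> carrier_vec n" using F assms(3) by (simp add: e_def)
  have z: "?F\<^sup>T *\<^sub>v x \<in> carrier_vec k" using F assms(3) by simp
  \<comment> \<open>The retained columns are columns of \<open>Q\<close>, so these inner products
    are the leading eigenvector coordinates of \<open>x\<close>.\<close>
  have Fz: "(?F\<^sup>T *\<^sub>v x) $ j = y $ j" if "j < k" for j
  proof -
    have "col ?F j = col Q j"
      using that Q assms(2) by (intro eq_vecI) (auto simp: first_cols_def)
    then show ?thesis using that F Q assms(2) by (simp add: y_def)
  qed
  have "Q\<^sup>T *\<^sub>v e = y - Q\<^sup>T *\<^sub>v (?F *\<^sub>v (?F\<^sup>T *\<^sub>v x))"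
    using Q F assms(3) unfolding e_def y_def
    by (simp add: assoc_mult_mat_vec[of ?F n k "?F\<^sup>T" n] mult_minus_distrib_mat_vec[of _ n n])
  also have "\<dots> = vec n (\<lambda>j. if j < k then 0 else y $ j)"
    using transpose_mult_first_cols_vec[OF orth _ z] assms(2) Q
    by (intro eq_vecI) (auto simp: Fz y_def)
  finally have Qe: "Q\<^sup>T *\<^sub>v e = vec n (\<lambda>j. if j < k then 0 else y $ j)" .
  have "sorted_eigenvalue \<Lambda> (k + 1) * (l2_norm e)\<^sup>2
      = (\<Sum>j<n. sorted_eigenvalue \<Lambda> (k + 1) * (if j < k then 0 else y $ j)\<^sup>2)"
    unfolding real_orthogonal_mat_transpose_isometry[OF orth e, symmetric] Qe
    by (simp add: l2_norm_square sum_distrib_left)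
  also have "\<dots> \<le> (\<Sum>j<n. \<Lambda> $$ (j, j) * (y $ j)\<^sup>2)"
  proof (rule sum_mono)
    fix j assume "j \<in> {..<n}"
    then have j: "j < n" by simp
    \<comment> \<open>For \<open>j < k\<close> the left side is 0 and the right side is nonnegative;
      for \<open>j \<ge> k\<close> the eigenvalues are compared by sortedness.\<close>
    show "sorted_eigenvalue \<Lambda> (k + 1) * (if j < k then 0 else y $ j)\<^sup>2 \<le> \<Lambda> $$ (j, j) * (y $ j)\<^sup>2"
      using eigendecomposition_diag_nonneg[OF assms(1) psd j]
        eigendecomposition_diag_entry[OF assms(1) j] j
        sorted_eigenvalue_mono[OF assms(1), of "k + 1" "j + 1"]
      by (auto intro!: mult_right_mono)
  qed
  also have "\<dots> = x \<bullet> (L *\<^sub>v x)"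
    unfolding y_def by (rule eigendecomposition_quadratic_form[OF assms(1,3), symmetric])
  finally show ?thesis unfolding e_def .
qed

section \<open>The error bound for the projected solution\<close>

theorem theorem6:
  fixes n k\<^sub>c \<rho>\<^sub>c k :: nat
    and W L\<^sub>c Q \<Lambda>\<^sub>c Q\<^sub>k M\<^sub>c :: "real mat"
    and \<delta>\<^sub>c :: real
    and c_bar c_tilde c c_star :: "nat \<Rightarrow> real vec"
  assumes graph: "weighted_graph n W"
    and L\<^sub>c: "L\<^sub>c = laplacian W"
    and eig: "sorted_eigendecomposition n L\<^sub>c Q \<Lambda>\<^sub>c"
    and k\<^sub>c: "1 \<le> k\<^sub>c" "k\<^sub>c < n"
    and Q\<^sub>k: "Q\<^sub>k = first_cols k\<^sub>c Q"
    and \<delta>\<^sub>c: "0 < \<delta>\<^sub>c" "\<delta>\<^sub>c < 1"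
    and \<rho>\<^sub>c: "1 \<le> \<rho>\<^sub>c"
    and M\<^sub>c: "col_subsampling_mat n \<rho>\<^sub>c M\<^sub>c"
    and rip: "\<forall>w \<in> vec_space.col_space n Q\<^sub>k.
      (1 - \<delta>\<^sub>c) * (l2_norm w)\<^sup>2 \<le> real n / real \<rho>\<^sub>c * (l2_norm (M\<^sub>c\<^sup>T *\<^sub>v w))\<^sup>2 \<and>
      real n / real \<rho>\<^sub>c * (l2_norm (M\<^sub>c\<^sup>T *\<^sub>v w))\<^sup>2 \<le> (1 + \<delta>\<^sub>c) * (l2_norm w)\<^sup>2"
    and gap: "0 < sorted_eigenvalue \<Lambda>\<^sub>c (k\<^sub>c + 1)"
    and c_bar: "\<forall>i \<in> {1..k}. c_bar i \<in> vec_space.col_space n Q\<^sub>k"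
    and c_tilde: "\<forall>i \<in> {1..k}. c_tilde i = M\<^sub>c\<^sup>T *\<^sub>v c_bar i"
    and c: "\<forall>i \<in> {1..k}. is_arg_min (\<lambda>x. x \<bullet> (L\<^sub>c *\<^sub>v x))
      (\<lambda>x. x \<in> carrier_vec n \<and> M\<^sub>c\<^sup>T *\<^sub>v x = c_tilde i) (c i)"
    and c_star: "\<forall>i \<in> {1..k}. c_star i = (Q\<^sub>k * Q\<^sub>k\<^sup>T) *\<^sub>v c i"
  shows "\<forall>i \<in> {1..k}. l2_norm (c_star i - c_bar i) \<le>
      sqrt (real n / (real \<rho>\<^sub>c * (1 - \<delta>\<^sub>c))) *
      sqrt (sorted_eigenvalue \<Lambda>\<^sub>c k\<^sub>c / sorted_eigenvalue \<Lambda>\<^sub>c (k\<^sub>c + 1)) * l2_norm (c_bar i)"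
proof
  fix i assume i: "i \<in> {1..k}"
  have Q: "Q \<in> carrier_mat n n"
    using eig unfolding sorted_eigendecomposition_def real_orthogonal_mat_def by auto
  have F: "Q\<^sub>k \<in> carrier_mat n k\<^sub>c" using Q by (simp add: Q\<^sub>k first_cols_def)
  have M: "M\<^sub>c \<in> carrier_mat n \<rho>\<^sub>c" using M\<^sub>c unfolding col_subsampling_mat_def by auto
  have span: "vec_space.col_space n Q\<^sub>k = {Q\<^sub>k *\<^sub>v z | z. z \<in> carrier_vec k\<^sub>c}"
    unfolding Q\<^sub>k by (rule col_space_first_cols[OF Q])
  have psd: "\<And>x. x \<in> carrier_vec n \<Longrightarrow> 0 \<le> x \<bullet> (L\<^sub>c *\<^sub>v x)"
    unfolding L\<^sub>c by (rule laplacian_psd[OF graph])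
  let ?lo = "sorted_eigenvalue \<Lambda>\<^sub>c k\<^sub>c" and ?hi = "sorted_eigenvalue \<Lambda>\<^sub>c (k\<^sub>c + 1)"
  define e where "e = c i - c_star i"
  define d where "d = c_star i - c_bar i"

  obtain z where z: "z \<in> carrier_vec k\<^sub>c" "c_bar i = Q\<^sub>k *\<^sub>v z"
    using c_bar[rule_format, OF i] unfolding span by auto
  have bar: "c_bar i \<in> carrier_vec n" using F z by simp
  \<comment> \<open>By definition of \<open>c_tilde i\<close>, the vector \<open>c_bar i\<close>
    satisfies the constraint and so competes in the minimisation.\<close>
  have ci: "c i \<in> carrier_vec n" and feas: "M\<^sub>c\<^sup>T *\<^sub>v c i = M\<^sub>c\<^sup>T *\<^sub>v c_bar i"
    and min: "c i \<bullet> (L\<^sub>c *\<^sub>v c i) \<le> c_bar i \<bullet> (L\<^sub>c *\<^sub>v c_bar i)"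
    using c c_tilde i bar by (auto simp: is_arg_min_linorder)
  have star: "c_star i = Q\<^sub>k *\<^sub>v (Q\<^sub>k\<^sup>T *\<^sub>v c i)"
    using c_star i F ci by (simp add: assoc_mult_mat_vec[of Q\<^sub>k n k\<^sub>c "Q\<^sub>k\<^sup>T" n])
  have star_carrier: "c_star i \<in> carrier_vec n" using F ci star by simp
  have e: "e \<in> carrier_vec n" using ci star_carrier by (simp add: e_def)

  have "d = Q\<^sub>k *\<^sub>v (Q\<^sub>k\<^sup>T *\<^sub>v c i - z)"
    using F ci z unfolding d_def star by (simp add: mult_minus_distrib_mat_vec[of _ n k\<^sub>c])
  then have d_span: "d \<in> vec_space.col_space n Q\<^sub>k"
    using F ci z(1) unfolding span by force
  \<comment> \<open>The sum \<open>d + e\<close> equals \<open>c i - c_bar i\<close>, whose samples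
    vanish by feasibility.\<close>
  have "M\<^sub>c\<^sup>T *\<^sub>v d = - (M\<^sub>c\<^sup>T *\<^sub>v e)"
    using M feas ci bar star_carrier unfolding d_def e_def
    by (auto simp: mult_minus_distrib_mat_vec[of _ \<rho>\<^sub>c n])
  then have Md: "l2_norm (M\<^sub>c\<^sup>T *\<^sub>v d) \<le> l2_norm e"
    using subsampling_norm_le[OF M\<^sub>c e] by (simp add: l2_norm_uminus)

  have "?hi * (l2_norm e)\<^sup>2 \<le> c i \<bullet> (L\<^sub>c *\<^sub>v c i)"
    using projection_residual_le_quadratic_form[OF eig k\<^sub>c(2) ci psd] c_star i
    by (simp add: e_def Q\<^sub>k)
  also note min
  also have "c_bar i \<bullet> (L\<^sub>c *\<^sub>v c_bar i) \<le> ?lo * (l2_norm (c_bar i))\<^sup>2"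
    using quadratic_form_le_on_low_eigenspace[OF eig k\<^sub>c(1)] k\<^sub>c(2) c_bar i Q\<^sub>k by simp
  \<comment> \<open>Positivity of the eigenvalue number \<open>k\<^sub>c + 1\<close> permits the
    division.\<close>
  finally have e_bound: "(l2_norm e)\<^sup>2 \<le> ?lo / ?hi * (l2_norm (c_bar i))\<^sup>2"
    using gap by (simp add: field_simps)

  have "(1 - \<delta>\<^sub>c) * (l2_norm d)\<^sup>2 \<le> real n / real \<rho>\<^sub>c * (l2_norm (M\<^sub>c\<^sup>T *\<^sub>v d))\<^sup>2"
    using rip d_span by blast
  also have "\<dots> \<le> real n / real \<rho>\<^sub>c * (l2_norm e)\<^sup>2"
    using Md by (intro mult_left_mono power_mono) (auto simp: l2_norm_nonneg)
  also have "\<dots> \<le> real n / real \<rho>\<^sub>c * (?lo / ?hi * (l2_norm (c_bar i))\<^sup>2)"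
    using e_bound by (intro mult_left_mono) auto
  finally have "(l2_norm d)\<^sup>2 \<le>
      real n / real \<rho>\<^sub>c * (?lo / ?hi * (l2_norm (c_bar i))\<^sup>2) / (1 - \<delta>\<^sub>c)"
    using \<delta>\<^sub>c by (subst pos_le_divide_eq) (simp_all add: mult.commute)
  also have "\<dots> = real n / (real \<rho>\<^sub>c * (1 - \<delta>\<^sub>c)) * (?lo / ?hi) * (l2_norm (c_bar i))\<^sup>2"
    by (simp add: mult_ac)
  finally have "sqrt ((l2_norm d)\<^sup>2) \<le>
      sqrt (real n / (real \<rho>\<^sub>c * (1 - \<delta>\<^sub>c)) * (?lo / ?hi) * (l2_norm (c_bar i))\<^sup>2)"
    by (rule real_sqrt_le_mono)
  \<comment> \<open>\<open>real_sqrt_mult\<close> holds for all reals, so the root splits into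
    factors without checking the sign of the eigenvalue ratio.\<close>
  then show "l2_norm (c_star i - c_bar i) \<le>
      sqrt (real n / (real \<rho>\<^sub>c * (1 - \<delta>\<^sub>c))) * sqrt (?lo / ?hi) * l2_norm (c_bar i)"
    by (simp only: real_sqrt_mult real_sqrt_abs abs_of_nonneg l2_norm_nonneg d_def)
qed

end
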